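(* Let $F$ be a (plane) forest of size $n\geq 1$. Then $$\sum_{(F,w)\in D_n(F)}q^{\mathrm{inv}_D(F,w)}=\frac{n!}{2\prod_{u\in F}h_u}\prod_{u\in F}(1+q^{h_u-1})[h_u].$$
   Context: Notation: $[1,n]=\{1,\dots,n\}$, and for a nonnegative integer $m$, $[m]=1+q+\cdots+q^{m-1}$. A forest $F$ is a (plane) rooted forest with vertex set $V(F)$; being plane, its vertices are regarded as distinguishable (implicitly labeled). Its size is the number of vertices. $F$ is regarded as a poset with the roots at the top: $v\le_F u$ iff $u$ lies on the path from $v$ to the root of its tree. The hook length $h_u$ of a vertex $u$ is the number of vertices of the subtree rooted at $u$, i.e. $h_u=|\{v\in F: v\le_F u\}|$. A signed labeling of a forest $F$ of size $n$ is a map $w:V(F)\to\{\pm1,\dots,\pm n\}$ such that $u\mapsto|w(u)|$ is a bijection from $V(F)$ to $[1,n]$. $D_n(F)$ denotes the set of all even-signed labeled forests $(F,w)$ with underlying forest $F$, i.e. signed labelings $w$ of $F$ with an even number of negative labels. Labels are compared in the natural order of the integers. For $(F,w)\in D_n(F)$ define - $\mathrm{inv}(F,w)=|\{(u,v): u>_F v,\ w(u)<w(v)\}|$; - $\mathrm{n}_2(F,w)=|\{(u,v): u<_F v,\ w(u)+w(v)<0\}|$; - $\mathrm{inv}_D(F,w)=\mathrm{inv}(F,w)+\mathrm{n}_2(F,w)$. *)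

theory Defs
  imports "HOL-Library.Sublist" "HOL-Library.FuncSet" "HOL-Computational_Algebra.Polynomial"
begin

text \<open>A plane tree is a root together with the list of its subtrees from left to right;
  a plane forest is a list of plane trees.\<close>

datatype plane_tree = Node "plane_tree list"

type_synonym plane_forest = "plane_tree list"

text \<open>Vertices are addresses: a vertex of a tree is the list of child indices read along the path
  from the root to it (the root being \<open>[]\<close>), and in a forest this list is preceded by the index
  of the tree. Hence the parent of a non-root vertex \<open>p @ [i]\<close> is \<open>p\<close>, the roots are the
  singletons \<open>[i]\<close>, and the vertices on the path from \<open>v\<close> to the root of its tree are the
  nonempty prefixes of \<open>v\<close>.\<close>

fun is_address :: "plane_tree \<Rightarrow> nat list \<Rightarrow> bool" where
  "is_address t [] \<longleftrightarrow> True"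
| "is_address (Node ts) (i # p) \<longleftrightarrow> i < length ts \<and> is_address (ts ! i) p"

definition vertices :: "plane_forest \<Rightarrow> nat list set" where
  "vertices F = {i # p | i p. i < length F \<and> is_address (F ! i) p}"

definition forest_size :: "plane_forest \<Rightarrow> nat" where
  "forest_size F = card (vertices F)"

definition forest_le :: "plane_forest \<Rightarrow> nat list \<Rightarrow> nat list \<Rightarrow> bool" where
  "forest_le F v u \<longleftrightarrow> v \<in> vertices F \<and> u \<in> vertices F \<and> prefix u v"

definition forest_less :: "plane_forest \<Rightarrow> nat list \<Rightarrow> nat list \<Rightarrow> bool" where
  "forest_less F v u \<longleftrightarrow> forest_le F v u \<and> v \<noteq> u"

definition hook :: "plane_forest \<Rightarrow> nat list \<Rightarrow> nat" where
  "hook F u = card {v \<in> vertices F. forest_le F v u}"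

text \<open>Labelings are extensional functions (\<open>undefined\<close> off the vertex set), so that distinct
  elements of the set below are distinct labelings of the vertices.\<close>

definition signed_labelings :: "plane_forest \<Rightarrow> (nat list \<Rightarrow> int) set" where
  "signed_labelings F =
    {w \<in> vertices F \<rightarrow>\<^sub>E {k. 1 \<le> \<bar>k\<bar> \<and> \<bar>k\<bar> \<le> int (forest_size F)}.
       bij_betw (\<lambda>u. \<bar>w u\<bar>) (vertices F) {1..int (forest_size F)}}"

definition even_signed_labelings :: "plane_forest \<Rightarrow> (nat list \<Rightarrow> int) set" where
  "even_signed_labelings F =
    {w \<in> signed_labelings F. even (card {u \<in> vertices F. w u < 0})}"

definition inv_count :: "plane_forest \<Rightarrow> (nat list \<Rightarrow> int) \<Rightarrow> nat" where
  "inv_count F w = card {(u, v). forest_less F v u \<and> w u < w v}"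

definition n2_count :: "plane_forest \<Rightarrow> (nat list \<Rightarrow> int) \<Rightarrow> nat" where
  "n2_count F w = card {(u, v). forest_less F u v \<and> w u + w v < 0}"

definition inv_D :: "plane_forest \<Rightarrow> (nat list \<Rightarrow> int) \<Rightarrow> nat" where
  "inv_D F w = inv_count F w + n2_count F w"

text \<open>The variable \<open>q\<close> is a formal indeterminate over the rationals.\<close>

definition qvar :: "rat poly" where
  "qvar = [:0, 1:]"

definition q_bracket :: "nat \<Rightarrow> rat poly" where
  "q_bracket m = (\<Sum>i<m. qvar ^ i)"

lemma vertices_tree_decomp:
  "{p. is_address (Node ts) p} = insert [] (vertices ts)"
proof -
  have "is_address (Node ts) p \<longleftrightarrow> p = [] \<or> p \<in> vertices ts" for p
    by (cases p) (auto simp: vertices_def)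
  then show ?thesis by auto
qed

lemma finite_vertices_aux:
  assumes "\<And>t. t \<in> set F \<Longrightarrow> finite {p. is_address t p}"
  shows "finite (vertices F)"
proof -
  have "vertices F = (\<Union>i<length F. (#) i ` {p. is_address (F ! i) p})"
    by (auto simp: vertices_def)
  then show ?thesis using assms by auto
qed

lemma finite_addresses: "finite {p. is_address t p}"
proof (induction t)
  case (Node ts)
  then show ?case by (simp add: vertices_tree_decomp finite_vertices_aux)
qed

lemma finite_vertices: "finite (vertices F)"
  by (rule finite_vertices_aux) (rule finite_addresses)

lemma finite_even_signed_labelings: "finite (even_signed_labelings F)"
proof -
  have "{k. 1 \<le> \<bar>k\<bar> \<and> \<bar>k\<bar> \<le> int n} \<subseteq> {- int n..int n}" for n by auto
  then have "finite {k. 1 \<le> \<bar>k\<bar> \<and> \<bar>k\<bar> \<le> int n}" for n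
    by (rule finite_subset) simp
  then show ?thesis
    unfolding even_signed_labelings_def signed_labelings_def
    by (simp add: finite_PiE finite_vertices)
qed

end

theory Submission
  imports Defs "HOL-Combinatorics.Transposition"
begin

text \<open>
  The statistic is a sum of local contributions, one for each vertex. Let \<open>v\<close> lie strictly below
  \<open>u\<close>. If \<open>\<bar>w v\<bar> > \<bar>w u\<bar>\<close>, exactly one of the conditions \<open>w u < w v\<close> and \<open>w u + w v < 0\<close> holds,
  according to the sign of \<open>w v\<close>; if \<open>\<bar>w v\<bar> < \<bar>w u\<bar>\<close>, both hold or both fail, according to the
  sign of \<open>w u\<close>. So the contribution of \<open>u\<close> depends only on the sign of \<open>w u\<close> and on the number
  \<open>d\<close> of vertices below \<open>u\<close> whose label is smaller than that of \<open>u\<close> in absolute value: with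
  \<open>h\<close> the hook length of \<open>u\<close>, it is \<open>h - 1 - d\<close> when \<open>w u > 0\<close> and \<open>h - 1 + d\<close> when \<open>w u < 0\<close>
  (\<open>inv_D_eq_sum_vertex_inv\<close>). Summed over the \<open>h\<close> values of \<open>d\<close> and both signs, the
  corresponding powers of \<open>q\<close> give \<open>(1 + q ^ (h - 1)) [h]\<close>.

  It remains to see that these local data are independent and uniformly distributed over all signed
  labelings. Fix \<open>u\<close>. For \<open>v\<close> weakly below \<open>u\<close> and a sign \<open>s\<close>, exchange the labels of \<open>u\<close> and
  \<open>v\<close> and multiply the new label of \<open>u\<close> by \<open>s\<close>. This permutes the signed labelings and changes
  no contribution of a vertex outside the subtree of \<open>u\<close>, while, as \<open>v\<close> and \<open>s\<close> vary, the label
  of \<open>u\<close> takes every rank within its subtree and both signs exactly once. Averaging over these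
  \<open>2 h\<close> permutations splits off the factor of \<open>u\<close>; doing so for one vertex after another, the
  deepest first, evaluates the sum over all \<open>2 ^ n n!\<close> signed labelings
  (\<open>sum_prod_vertex_inv\<close>).

  Finally a leaf contributes \<open>0\<close> whatever its sign, so changing the sign of the label of one leaf
  matches even-signed labelings with odd-signed ones and preserves the statistic. The even-signed
  labelings therefore account for exactly half of the sum.
\<close>

section \<open>Local contributions of the vertices\<close>

definition descendants :: "plane_forest \<Rightarrow> nat list \<Rightarrow> nat list set" where
  "descendants F u = {v \<in> vertices F. prefix u v}"

definition vertex_inv :: "plane_forest \<Rightarrow> (nat list \<Rightarrow> int) \<Rightarrow> nat list \<Rightarrow> nat" where
  "vertex_inv F w u = card {v \<in> descendants F u. \<bar>w u\<bar> < \<bar>w v\<bar>} +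
     (if w u < 0 then 2 * card {v \<in> descendants F u. \<bar>w v\<bar> < \<bar>w u\<bar>} else 0)"

lemma finite_descendants: "finite (descendants F u)"
  by (simp add: descendants_def finite_vertices)

lemma descendants_subset: "descendants F u \<subseteq> vertices F"
  by (auto simp: descendants_def)

lemma hook_eq_card_descendants:
  assumes "u \<in> vertices F"
  shows "hook F u = card (descendants F u)"
  using assms unfolding hook_def descendants_def forest_le_def
  by (intro arg_cong[of _ _ card]) auto

lemma hook_pos:
  assumes "u \<in> vertices F"
  shows "0 < hook F u"
  using assms finite_descendants[of F u]
  by (auto simp: hook_eq_card_descendants card_gt_0_iff descendants_def)

lemma signed_labelings_inj:
  assumes "w \<in> signed_labelings F"
  shows "inj_on (\<lambda>u. \<bar>w u\<bar>) (vertices F)"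
  using assms by (auto simp: signed_labelings_def bij_betw_def)

lemma signed_labelings_nonzero:
  assumes "w \<in> signed_labelings F" "u \<in> vertices F"
  shows "w u \<noteq> 0"
  using assms by (force simp: signed_labelings_def)

text \<open>For \<open>w u > 0\<close> the two sets counted on the left partition the vertices with a larger absolute
  label; for \<open>w u < 0\<close> they cover all proper descendants and overlap in those with a smaller
  absolute label, which are hence counted twice.\<close>

lemma card_inversions_at_vertex:
  assumes w: "w \<in> signed_labelings F" and u: "u \<in> vertices F"
  shows "card {v. forest_less F v u \<and> w u < w v} + card {v. forest_less F v u \<and> w v + w u < 0}
    = vertex_inv F w u"
proof -
  let ?D = "descendants F u"
  let ?I = "{v. forest_less F v u \<and> w u < w v}" and ?N = "{v. forest_less F v u \<and> w v + w u < 0}"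
  let ?A = "{v \<in> ?D. \<bar>w u\<bar> < \<bar>w v\<bar>}" and ?B = "{v \<in> ?D. \<bar>w v\<bar> < \<bar>w u\<bar>}"
  have less: "forest_less F v u \<longleftrightarrow> v \<in> ?D \<and> v \<noteq> u" for v
    using u by (auto simp: forest_less_def forest_le_def descendants_def)
  have neq: "\<bar>w v\<bar> \<noteq> \<bar>w u\<bar>" if "v \<in> ?D" "v \<noteq> u" for v
    using that signed_labelings_inj[OF w] u descendants_subset[of F u]
    by (auto dest: inj_onD)
  have fin: "finite ?I" "finite ?N" "finite ?A" "finite ?B"
    using finite_descendants[of F u] by (simp_all add: less)
  have sum: "card ?I + card ?N = card (?I \<union> ?N) + card (?I \<inter> ?N)"
    using fin by (intro card_Un_Int)
  show ?thesis
  proof (cases "w u < 0")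
    case True
    have "?I \<union> ?N = ?A \<union> ?B" "?I \<inter> ?N = ?B"
      using True neq by (fastforce simp: less)+
    moreover have "card (?A \<union> ?B) = card ?A + card ?B"
      using fin by (intro card_Un_disjoint) auto
    ultimately show ?thesis
      using sum True by (simp add: vertex_inv_def)
  next
    case False
    have "?I \<union> ?N = ?A" "?I \<inter> ?N = {}"
      using False neq by (fastforce simp: less)+
    then show ?thesis
      using sum False by (simp add: vertex_inv_def)
  qed
qed

lemma inv_D_eq_sum_vertex_inv:
  assumes w: "w \<in> signed_labelings F"
  shows "inv_D F w = (\<Sum>u\<in>vertices F. vertex_inv F w u)"
proof -
  let ?V = "vertices F"
  let ?I = "\<lambda>u. {v. forest_less F v u \<and> w u < w v}"
  let ?N = "\<lambda>u. {v. forest_less F v u \<and> w v + w u < 0}"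
  have fin: "finite (?I u)" "finite (?N u)" for u
    by (rule finite_subset[OF _ finite_vertices[of F]]; auto simp: forest_less_def forest_le_def)+
  have "{(u, v). forest_less F v u \<and> w u < w v} = (SIGMA u:?V. ?I u)"
    by (auto simp: forest_less_def forest_le_def)
  then have inv: "inv_count F w = (\<Sum>u\<in>?V. card (?I u))"
    by (simp add: inv_count_def card_SigmaI finite_vertices fin)
  have "{(u, v). forest_less F u v \<and> w u + w v < 0} = prod.swap ` (SIGMA u:?V. ?N u)"
    by (auto simp: forest_less_def forest_le_def image_iff)
  then have n2: "n2_count F w = (\<Sum>u\<in>?V. card (?N u))"
    by (simp add: n2_count_def card_image card_SigmaI finite_vertices fin)
  show ?thesis
    by (simp add: inv_D_def inv n2 flip: sum.distrib card_inversions_at_vertex[OF w])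
qed

section \<open>Exchanging labels within a subtree\<close>

text \<open>When \<open>u = v\<close> the second update prevails, and only the sign of the label is changed.\<close>

definition relabel :: "('a \<Rightarrow> int) \<Rightarrow> 'a \<Rightarrow> 'a \<Rightarrow> int \<Rightarrow> 'a \<Rightarrow> int" where
  "relabel w u v s = w(v := w u, u := s * w v)"

lemma relabel_abs:
  assumes "s \<in> {1, -1}"
  shows "\<bar>relabel w u v s x\<bar> = \<bar>w (transpose u v x)\<bar>"
  using assms by (auto simp: relabel_def transpose_def)

lemma relabel_in_signed_labelings:
  assumes "w \<in> signed_labelings F" "u \<in> vertices F" "v \<in> vertices F" "s \<in> {1, -1}"
  shows "relabel w u v s \<in> signed_labelings F"
proof -
  let ?V = "vertices F"
  have "bij_betw (\<lambda>x. \<bar>w x\<bar>) ?V {1..int (forest_size F)}"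
    using assms(1) by (simp add: signed_labelings_def)
  then have "bij_betw ((\<lambda>x. \<bar>w x\<bar>) \<circ> transpose u v) ?V {1..int (forest_size F)}"
    using assms(2,3) by (intro bij_betw_trans[of "transpose u v"]) auto
  then have bij: "bij_betw (\<lambda>x. \<bar>relabel w u v s x\<bar>) ?V {1..int (forest_size F)}"
    by (simp add: relabel_abs[OF assms(4)] comp_def)
  then have "\<And>x. x \<in> ?V \<Longrightarrow> \<bar>relabel w u v s x\<bar> \<in> {1..int (forest_size F)}"
    by (rule bij_betwE[THEN bspec])
  moreover have "relabel w u v s \<in> extensional ?V"
    using assms by (auto simp: relabel_def signed_labelings_def PiE_def extensional_def)
  ultimately show ?thesis
    using bij by (auto simp: signed_labelings_def PiE_def)
qed

lemma finite_signed_labelings: "finite (signed_labelings F)"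
proof -
  have "{k. 1 \<le> \<bar>k\<bar> \<and> \<bar>k\<bar> \<le> int n} \<subseteq> {- int n..int n}" for n by auto
  then have "finite {k. 1 \<le> \<bar>k\<bar> \<and> \<bar>k\<bar> \<le> int n}" for n
    by (rule finite_subset) simp
  then show ?thesis
    by (simp add: signed_labelings_def finite_PiE finite_vertices)
qed

lemma bij_betw_relabel:
  assumes "u \<in> vertices F" "v \<in> vertices F" "s \<in> {1, -1}"
  shows "bij_betw (\<lambda>w. relabel w u v s) (signed_labelings F) (signed_labelings F)"
proof -
  have "s * s = 1"
    using assms(3) by auto
  \<comment> \<open>the inverse exchanges the labels back; for \<open>u = v\<close> the factor \<open>s\<close> is needed in the last update\<close>
  then have "(relabel w u v s)(u := relabel w u v s v, v := s * relabel w u v s u) = w" for w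
    by (auto simp: relabel_def fun_eq_iff simp flip: mult.assoc)
  then have "inj_on (\<lambda>w. relabel w u v s) (signed_labelings F)"
    by (intro inj_on_inverseI[where g = "\<lambda>w'. w'(u := w' v, v := s * w' u)"])
  then show ?thesis
    using assms finite_signed_labelings
    by (intro bij_betw_imageI endo_inj_surj) (auto intro: relabel_in_signed_labelings)
qed

lemma card_Collect_transpose:
  assumes "u \<in> D \<longleftrightarrow> v \<in> D"
  shows "card {y \<in> D. P (transpose u v y)} = card {y \<in> D. P y}"
proof -
  have mem: "transpose u v y \<in> D \<longleftrightarrow> y \<in> D" for y
    using assms by (simp add: transpose_def)
  have "bij_betw (transpose u v) {y \<in> D. P (transpose u v y)} {y \<in> D. P y}"
    by (rule bij_betw_byWitness[of _ "transpose u v"]) (auto simp: mem)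
  then show ?thesis
    by (rule bij_betw_same_card)
qed

text \<open>The hook of a vertex outside the subtree of \<open>u\<close> either contains this subtree or is disjoint
  from it, so the set of absolute labels in the hook does not change.\<close>

lemma vertex_inv_relabel_outside:
  assumes u: "u \<in> vertices F" and v: "v \<in> descendants F u" and s: "s \<in> {1, -1}"
    and x: "\<not> prefix u x"
  shows "vertex_inv F (relabel w u v s) x = vertex_inv F w x"
proof -
  have "prefix u v" "v \<in> vertices F"
    using v by (auto simp: descendants_def)
  then have mem: "u \<in> descendants F x \<longleftrightarrow> v \<in> descendants F x"
    using u x prefix_same_cases[of x v u] by (auto simp: descendants_def intro: prefix_order.trans)
  have "x \<noteq> u" "x \<noteq> v"
    using x \<open>prefix u v\<close> by auto
  then have eq: "relabel w u v s x = w x"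
    by (simp add: relabel_def)
  show ?thesis
    unfolding vertex_inv_def eq
    using card_Collect_transpose[OF mem, of "\<lambda>y. \<bar>w x\<bar> < \<bar>w y\<bar>"]
      card_Collect_transpose[OF mem, of "\<lambda>y. \<bar>w y\<bar> < \<bar>w x\<bar>"]
    by (simp only: relabel_abs[OF s])
qed

lemma vertex_inv_relabel_at:
  assumes u: "u \<in> vertices F" and v: "v \<in> descendants F u" and s: "s \<in> {1, -1}"
  shows "vertex_inv F (relabel w u v s) u = card {y \<in> descendants F u. \<bar>w v\<bar> < \<bar>w y\<bar>} +
    (if s * w v < 0 then 2 * card {y \<in> descendants F u. \<bar>w y\<bar> < \<bar>w v\<bar>} else 0)"
proof -
  have mem: "u \<in> descendants F u \<longleftrightarrow> v \<in> descendants F u"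
    using u v by (auto simp: descendants_def)
  have eq: "relabel w u v s u = s * w v"
    by (simp add: relabel_def)
  show ?thesis
    unfolding vertex_inv_def relabel_abs[OF s]
    using card_Collect_transpose[OF mem, of "\<lambda>y. \<bar>w v\<bar> < \<bar>w y\<bar>"]
      card_Collect_transpose[OF mem, of "\<lambda>y. \<bar>w y\<bar> < \<bar>w v\<bar>"]
    by (simp only: transpose_apply_first eq)
qed

section \<open>The factor of a single vertex\<close>

text \<open>The rank strictly increases with the value of \<open>f\<close>, so distinct elements have distinct ranks,
  and there are only \<open>card S\<close> possible ranks.\<close>

lemma bij_betw_rank:
  fixes f :: "'a \<Rightarrow> 'b::linorder"
  assumes fin: "finite S" and inj: "inj_on f S"
  shows "bij_betw (\<lambda>v. card {y \<in> S. f y < f v}) S {..<card S}"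
proof -
  let ?r = "\<lambda>v. card {y \<in> S. f y < f v}"
  have mono: "?r v < ?r v'" if "v \<in> S" "f v < f v'" for v v'
    using that fin by (intro psubset_card_mono) (auto dest: less_trans)
  have "inj_on ?r S"
  proof (rule inj_onI)
    fix v v' assume *: "v \<in> S" "v' \<in> S" "?r v = ?r v'"
    then have "f v = f v'"
      using mono[of v v'] mono[of v' v] by (metis linorder_neqE nat_less_le)
    then show "v = v'"
      using * inj by (auto dest: inj_onD)
  qed
  moreover have "?r ` S \<subseteq> {..<card S}"
    using fin by (auto intro!: psubset_card_mono)
  ultimately show ?thesis
    using fin by (simp add: bij_betw_def card_image card_subset_eq)
qed

text \<open>With \<open>h = card S\<close>, an element of rank \<open>d\<close> contributes \<open>q ^ (h - 1 - d) + q ^ (h - 1 + d)\<close>.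
  As \<open>d\<close> runs through \<open>0, \<dots>, h - 1\<close>, the first terms add up to \<open>[h]\<close> and the second to
  \<open>q ^ (h - 1) [h]\<close>.\<close>

lemma sum_signed_rank_powers:
  fixes f :: "'a \<Rightarrow> 'b::linorder"
  assumes fin: "finite S" and inj: "inj_on f S"
  shows "(\<Sum>v\<in>S. qvar ^ card {y \<in> S. f v < f y} +
      qvar ^ (card {y \<in> S. f v < f y} + 2 * card {y \<in> S. f y < f v})) =
    (1 + qvar ^ (card S - 1)) * q_bracket (card S)"
proof -
  let ?h = "card S" and ?r = "\<lambda>v. card {y \<in> S. f y < f v}"
  have rank: "bij_betw ?r S {..<?h}"
    by (rule bij_betw_rank[OF fin inj])
  have above: "card {y \<in> S. f v < f y} = ?h - Suc (?r v) \<and> ?r v < ?h" if "v \<in> S" for v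
  proof -
    have "S = insert v ({y \<in> S. f y < f v} \<union> {y \<in> S. f v < f y})"
      using that inj by (auto dest: inj_onD simp: not_less order.order_iff_strict)
    moreover have "card (insert v ({y \<in> S. f y < f v} \<union> {y \<in> S. f v < f y})) =
        Suc (?r v + card {y \<in> S. f v < f y})"
      using fin by (subst card_insert_disjoint) (auto intro!: card_Un_disjoint)
    ultimately show ?thesis
      by simp
  qed
  have "(\<Sum>v\<in>S. qvar ^ card {y \<in> S. f v < f y} +
        qvar ^ (card {y \<in> S. f v < f y} + 2 * ?r v)) =
      (\<Sum>v\<in>S. qvar ^ (?h - Suc (?r v)) + qvar ^ (?h - 1) * qvar ^ ?r v)"
  proof (rule sum.cong)
    fix v assume "v \<in> S"
    then have a: "card {y \<in> S. f v < f y} = ?h - Suc (?r v)"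
      and b: "card {y \<in> S. f v < f y} + 2 * ?r v = (?h - 1) + ?r v"
      using above[of v] by auto
    show "qvar ^ card {y \<in> S. f v < f y} + qvar ^ (card {y \<in> S. f v < f y} + 2 * ?r v) =
        qvar ^ (?h - Suc (?r v)) + qvar ^ (?h - 1) * qvar ^ ?r v"
      unfolding b unfolding a by (simp only: power_add)
  qed simp
  also have "\<dots> = (\<Sum>d<?h. qvar ^ (?h - Suc d) + qvar ^ (?h - 1) * qvar ^ d)"
    by (rule sum.reindex_bij_betw[OF rank])
  also have "\<dots> = q_bracket ?h + qvar ^ (?h - 1) * q_bracket ?h"
    by (simp add: sum.distrib sum_distrib_left q_bracket_def sum.nat_diff_reindex)
  finally show ?thesis
    by (simp add: algebra_simps)
qed

lemma sum_vertex_inv_relabel: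
  assumes w: "w \<in> signed_labelings F" and u: "u \<in> vertices F"
  shows "(\<Sum>v\<in>descendants F u. \<Sum>s\<in>{1, -1}. qvar ^ vertex_inv F (relabel w u v s) u) =
    (1 + qvar ^ (hook F u - 1)) * q_bracket (hook F u)"
proof -
  let ?D = "descendants F u"
  have "(\<Sum>s\<in>{1, -1}. qvar ^ vertex_inv F (relabel w u v s) u) =
      qvar ^ card {y \<in> ?D. \<bar>w v\<bar> < \<bar>w y\<bar>} +
      qvar ^ (card {y \<in> ?D. \<bar>w v\<bar> < \<bar>w y\<bar>} + 2 * card {y \<in> ?D. \<bar>w y\<bar> < \<bar>w v\<bar>})"
    if "v \<in> ?D" for v
  proof -
    have "w v \<noteq> 0"
      using signed_labelings_nonzero[OF w] that descendants_subset by blast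
    then show ?thesis
      using vertex_inv_relabel_at[OF u that, of 1 w] vertex_inv_relabel_at[OF u that, of "-1" w]
      by (cases "w v < 0") auto
  qed
  then show ?thesis
    using sum_signed_rank_powers[OF finite_descendants
        inj_on_subset[OF signed_labelings_inj[OF w] descendants_subset], of u]
    by (simp add: hook_eq_card_descendants[OF u])
qed

section \<open>The sum over all signed labelings\<close>

text \<open>Only the vertices in \<open>X\<close> contribute, and they are added in order of increasing depth. For a
  new vertex \<open>u\<close> no element of \<open>X\<close> lies below \<open>u\<close>, so that \<open>relabel _ u v s\<close> preserves the
  weight of \<open>X\<close>.\<close>

lemma sum_prod_vertex_inv:
  assumes "X \<subseteq> vertices F"
  shows "of_nat (\<Prod>u\<in>X. 2 * hook F u) *
      (\<Sum>w\<in>signed_labelings F. \<Prod>u\<in>X. qvar ^ vertex_inv F w u) =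
    of_nat (card (signed_labelings F)) *
      (\<Prod>u\<in>X. (1 + qvar ^ (hook F u - 1)) * q_bracket (hook F u))"
proof -
  have "finite X"
    using assms finite_vertices finite_subset by blast
  then show ?thesis
    using assms
  proof (induction X rule: finite_ranking_induct[of _ _ length])
    case empty
    show ?case by simp
  next
    case (insert u X)
    show ?case
    proof (cases "u \<in> X")
      case True
      then show ?thesis
        using insert by (simp add: insert_absorb)
    next
      case False
      let ?L = "signed_labelings F" and ?D = "descendants F u"
      let ?g = "\<lambda>w. \<Prod>x\<in>X. qvar ^ vertex_inv F w x"
      let ?c = "\<lambda>x. (1 + qvar ^ (hook F x - 1)) * q_bracket (hook F x)"
      have u: "u \<in> vertices F"
        using insert.prems by simp
      have outside: "\<not> prefix u x" if "x \<in> X" for x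
        using insert.hyps(2)[OF that] False that
        by (metis not_equal_is_parallel parallelD1 prefix_length_le le_antisym)
      have inv: "?g (relabel w u v s) = ?g w" if "v \<in> ?D" "s \<in> {1, -1}" for w v s
        using outside vertex_inv_relabel_outside[OF u that] by (intro prod.cong) auto
      have reindex: "(\<Sum>w\<in>?L. ?g w * qvar ^ vertex_inv F w u) =
          (\<Sum>w\<in>?L. ?g w * qvar ^ vertex_inv F (relabel w u v s) u)"
        if "v \<in> ?D" "s \<in> {1, -1}" for v s
      proof -
        have "v \<in> vertices F"
          using that(1) descendants_subset by blast
        then show ?thesis
          using sum.reindex_bij_betw[OF bij_betw_relabel[OF u _ that(2)],
              of v "\<lambda>w. ?g w * qvar ^ vertex_inv F w u"]
          by (simp add: inv[OF that])
      qed
      have "of_nat (2 * hook F u) * (\<Sum>w\<in>?L. ?g w * qvar ^ vertex_inv F w u) =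
          (\<Sum>v\<in>?D. \<Sum>s\<in>{1, -1::int}. \<Sum>w\<in>?L. ?g w * qvar ^ vertex_inv F w u)"
        by (simp add: hook_eq_card_descendants[OF u] mult.assoc mult.left_commute)
      also have "\<dots> = (\<Sum>v\<in>?D. \<Sum>s\<in>{1, -1}. \<Sum>w\<in>?L.
          ?g w * qvar ^ vertex_inv F (relabel w u v s) u)"
        by (intro sum.cong reindex refl)
      also have "\<dots> = (\<Sum>v\<in>?D. \<Sum>w\<in>?L. \<Sum>s\<in>{1, -1}.
          ?g w * qvar ^ vertex_inv F (relabel w u v s) u)"
        by (intro sum.cong refl sum.swap)
      also have "\<dots> = (\<Sum>w\<in>?L. \<Sum>v\<in>?D. \<Sum>s\<in>{1, -1}.
          ?g w * qvar ^ vertex_inv F (relabel w u v s) u)"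
        by (rule sum.swap)
      also have "\<dots> = (\<Sum>w\<in>?L. ?g w * ?c u)"
        by (intro sum.cong refl)
          (simp only: sum_distrib_left[symmetric] sum_vertex_inv_relabel[OF _ u])
      also have "\<dots> = ?c u * (\<Sum>w\<in>?L. ?g w)"
        by (simp only: sum_distrib_right[symmetric] mult.commute)
      finally have split: "of_nat (2 * hook F u) *
          (\<Sum>w\<in>?L. ?g w * qvar ^ vertex_inv F w u) = ?c u * (\<Sum>w\<in>?L. ?g w)" .
      have "of_nat (\<Prod>x\<in>insert u X. 2 * hook F x) *
            (\<Sum>w\<in>?L. \<Prod>x\<in>insert u X. qvar ^ vertex_inv F w x) =
          of_nat (\<Prod>x\<in>X. 2 * hook F x) *
            (of_nat (2 * hook F u) * (\<Sum>w\<in>?L. ?g w * qvar ^ vertex_inv F w u))"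
        by (simp only: prod.insert[OF insert.hyps(1) False] of_nat_mult) (simp only: ac_simps)
      also have "\<dots> = ?c u * (of_nat (\<Prod>x\<in>X. 2 * hook F x) * (\<Sum>w\<in>?L. ?g w))"
        unfolding split by (simp only: mult.left_commute)
      also have "\<dots> = ?c u * (of_nat (card ?L) * (\<Prod>x\<in>X. ?c x))"
        using insert by simp
      also have "\<dots> = of_nat (card ?L) * (\<Prod>x\<in>insert u X. ?c x)"
        by (simp only: prod.insert[OF insert.hyps(1) False] mult.left_commute)
      finally show ?thesis .
    qed
  qed
qed

text \<open>A signed labeling amounts to the set of vertices with negative label and the bijection of
  absolute values.\<close>

lemma card_signed_labelings:
  "card (signed_labelings F) = 2 ^ forest_size F * fact (forest_size F)"
proof -
  let ?V = "vertices F" and ?n = "forest_size F"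
  let ?P = "{\<sigma> \<in> ?V \<rightarrow>\<^sub>E {1..int ?n}. inj_on \<sigma> ?V}"
  let ?f = "\<lambda>w. ({u \<in> ?V. w u < 0}, \<lambda>u\<in>?V. \<bar>w u\<bar>)"
  let ?g = "\<lambda>(N, \<sigma>). \<lambda>u\<in>?V. if u \<in> N then - \<sigma> u else \<sigma> u"
  have "bij_betw ?f (signed_labelings F) (Pow ?V \<times> ?P)"
  proof (rule bij_betw_byWitness[of _ ?g])
    show "\<forall>w\<in>signed_labelings F. ?g (?f w) = w"
      by (auto simp: signed_labelings_def fun_eq_iff PiE_def extensional_def)
    show "\<forall>p\<in>Pow ?V \<times> ?P. ?f (?g p) = p"
    proof (intro ballI)
      fix p assume p: "p \<in> Pow ?V \<times> ?P"
      then obtain N \<sigma> where [simp]: "p = (N, \<sigma>)" and N: "N \<subseteq> ?V"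
        and \<sigma>: "\<sigma> \<in> ?V \<rightarrow>\<^sub>E {1..int ?n}" by auto
      have pos: "0 < \<sigma> u" if "u \<in> ?V" for u
        using PiE_mem[OF \<sigma> that] by simp
      have "{u \<in> ?V. ?g p u < 0} = N"
        using pos N by (auto split: if_splits dest: less_asym)
      moreover have "(\<lambda>u\<in>?V. \<bar>?g p u\<bar>) = \<sigma>"
        using pos PiE_arb[OF \<sigma>] by (auto simp: fun_eq_iff less_imp_le)
      ultimately show "?f (?g p) = p" by simp
    qed
    show "?f ` signed_labelings F \<subseteq> Pow ?V \<times> ?P"
      by (auto simp: signed_labelings_def bij_betw_def)
    show "?g ` (Pow ?V \<times> ?P) \<subseteq> signed_labelings F"
    proof (intro image_subsetI)
      fix p assume "p \<in> Pow ?V \<times> ?P"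
      then obtain N \<sigma> where [simp]: "p = (N, \<sigma>)"
        and \<sigma>: "\<sigma> \<in> ?V \<rightarrow>\<^sub>E {1..int ?n}" and inj: "inj_on \<sigma> ?V" by auto
      have range: "1 \<le> \<sigma> u \<and> \<sigma> u \<le> int ?n" if "u \<in> ?V" for u
        using PiE_mem[OF \<sigma> that] by simp
      have abs: "\<bar>?g p u\<bar> = \<sigma> u" if "u \<in> ?V" for u
        using range[OF that] that by auto
      have "\<sigma> ` ?V = {1..int ?n}"
        using range by (intro card_subset_eq) (auto simp: card_image[OF inj] forest_size_def)
      then have "bij_betw \<sigma> ?V {1..int ?n}"
        using inj by (simp add: bij_betw_def)
      then have "bij_betw (\<lambda>u. \<bar>?g p u\<bar>) ?V {1..int ?n}"
        using abs by (subst bij_betw_cong[of _ _ \<sigma>]) auto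
      moreover have "?g p \<in> ?V \<rightarrow>\<^sub>E {k. 1 \<le> \<bar>k\<bar> \<and> \<bar>k\<bar> \<le> int ?n}"
        using abs range by (auto simp: PiE_def)
      ultimately show "?g p \<in> signed_labelings F"
        unfolding signed_labelings_def by blast
    qed
  qed
  then have "card (signed_labelings F) = card (Pow ?V) * card ?P"
    by (simp add: bij_betw_same_card card_cartesian_product)
  also have "card ?P = fact ?n"
    using card_inj_on_subset_funcset[of ?V "{1..int ?n}" ?V] finite_vertices[of F]
    by (simp add: forest_size_def fact_prod_rev)
  finally show ?thesis
    by (simp add: card_Pow finite_vertices forest_size_def)
qed

section \<open>Restriction to even-signed labelings\<close>

lemma card_negative_flip:
  assumes "finite V" "u \<in> V" "w u \<noteq> 0"
  shows "even (card {x \<in> V. relabel w u u (-1) x < 0}) \<longleftrightarrow> odd (card {x \<in> V. w x < 0})"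
proof -
  let ?N = "{x \<in> V - {u}. w x < 0}"
  have fin: "finite ?N" "u \<notin> ?N"
    using assms by auto
  show ?thesis
  proof (cases "w u < 0")
    case True
    then have "{x \<in> V. relabel w u u (-1) x < 0} = ?N" "{x \<in> V. w x < 0} = insert u ?N"
      using assms by (auto simp: relabel_def)
    then show ?thesis
      using fin by simp
  next
    case False
    then have "{x \<in> V. relabel w u u (-1) x < 0} = insert u ?N" "{x \<in> V. w x < 0} = ?N"
      using assms by (auto simp: relabel_def)
    then show ?thesis
      using fin by simp
  qed
qed

lemma exists_leaf:
  assumes "vertices F \<noteq> {}"
  obtains u where "u \<in> vertices F" "descendants F u = {u}"
proof -
  obtain u where u: "u \<in> vertices F" "\<And>v. v \<in> vertices F \<Longrightarrow> length v \<le> length u"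
    using Max_in[of "length ` vertices F"] Max_ge[of "length ` vertices F"] assms finite_vertices[of F]
    by (metis (no_types, lifting) finite_imageI image_iff image_is_empty)
  have "v = u" if "v \<in> vertices F" "prefix u v" for v
    using u(2)[OF that(1)] that(2)
    by (metis not_equal_is_parallel parallelD1 prefix_length_le le_antisym)
  then have "descendants F u = {u}"
    using u by (auto simp: descendants_def)
  then show ?thesis
    using that u by blast
qed

lemma sum_even_signed_labelings:
  assumes "vertices F \<noteq> {}"
  shows "(\<Sum>w\<in>signed_labelings F. qvar ^ inv_D F w) =
    2 * (\<Sum>w\<in>even_signed_labelings F. qvar ^ inv_D F w)"
proof -
  let ?L = "signed_labelings F" and ?E = "even_signed_labelings F"
  obtain u where u: "u \<in> vertices F" and leaf: "descendants F u = {u}"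
    using exists_leaf[OF assms] .
  let ?t = "\<lambda>w. relabel w u u (-1)"
  have leaf_inv: "vertex_inv F w' u = 0" for w'
  proof -
    have "{v \<in> {u}. \<bar>w' u\<bar> < \<bar>w' v\<bar>} = {}" "{v \<in> {u}. \<bar>w' v\<bar> < \<bar>w' u\<bar>} = {}"
      by auto
    then show ?thesis
      by (simp only: vertex_inv_def leaf) simp
  qed
  have parity: "?t w \<in> ?E \<longleftrightarrow> w \<notin> ?E" if "w \<in> ?L" for w
    using that relabel_in_signed_labelings[OF that u u, of "-1"]
      card_negative_flip[of _ _ w, OF finite_vertices u signed_labelings_nonzero[OF that u]]
    by (auto simp: even_signed_labelings_def)
  have inv: "inv_D F (?t w) = inv_D F w" if "w \<in> ?L" for w
  proof -
    have "vertex_inv F (?t w) x = vertex_inv F w x" if x: "x \<in> vertices F" for x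
    proof (cases "x = u")
      case True
      then show ?thesis by (simp add: leaf_inv)
    next
      case False
      then have "\<not> prefix u x"
        using leaf x by (auto simp: descendants_def)
      then show ?thesis
        using leaf by (intro vertex_inv_relabel_outside[OF u]) auto
    qed
    then show ?thesis
      using that relabel_in_signed_labelings[OF that u u, of "-1"]
      by (simp add: inv_D_eq_sum_vertex_inv)
  qed
  have sub: "?E \<subseteq> ?L"
    by (auto simp: even_signed_labelings_def)
  have twice: "?t (?t w) = w" for w
    by (auto simp: relabel_def)
  have "bij_betw ?t ?E (?L - ?E)"
    using sub parity relabel_in_signed_labelings[OF _ u u, of _ "-1"]
    by (intro bij_betw_byWitness[of _ ?t]) (auto simp: twice)
  then have "(\<Sum>w\<in>?L - ?E. qvar ^ inv_D F w) = (\<Sum>w\<in>?E. qvar ^ inv_D F (?t w))"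
    by (rule sum.reindex_bij_betw[symmetric])
  also have "\<dots> = (\<Sum>w\<in>?E. qvar ^ inv_D F w)"
    using sub inv by (intro sum.cong) auto
  finally show ?thesis
    using sum.subset_diff[OF sub finite_signed_labelings, of "\<lambda>w. qvar ^ inv_D F w"] by simp
qed

theorem theorem2p2:
  fixes F :: plane_forest and n :: nat
  assumes "forest_size F = n" and "n \<ge> 1"
  shows "(\<Sum>w\<in>even_signed_labelings F. qvar ^ inv_D F w) =
    smult (fact n / (2 * (\<Prod>u\<in>vertices F. of_nat (hook F u))))
      (\<Prod>u\<in>vertices F. (1 + qvar ^ (hook F u - 1)) * q_bracket (hook F u))"
proof -
  let ?V = "vertices F"
  let ?E = "\<Sum>w\<in>even_signed_labelings F. qvar ^ inv_D F w"
  let ?R = "\<Prod>u\<in>?V. (1 + qvar ^ (hook F u - 1)) * q_bracket (hook F u)"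
  let ?H = "\<Prod>u\<in>?V. of_nat (hook F u) :: rat"
  have card: "card ?V = n"
    using assms by (simp add: forest_size_def)
  then have "?V \<noteq> {}"
    using assms(2) by auto
  have "(\<Sum>w\<in>signed_labelings F. \<Prod>u\<in>?V. qvar ^ vertex_inv F w u) = 2 * ?E"
    by (simp add: inv_D_eq_sum_vertex_inv power_sum flip: sum_even_signed_labelings[OF \<open>?V \<noteq> {}\<close>])
  then have "of_nat (\<Prod>u\<in>?V. 2 * hook F u) * (2 * ?E) = of_nat (2 ^ n * fact n) * ?R"
    using sum_prod_vertex_inv[of ?V F] by (simp add: card_signed_labelings assms(1))
  moreover have "(\<Prod>u\<in>?V. 2 * of_nat (hook F u)) = 2 ^ n * ?H"
    by (simp add: prod.distrib card)
  ultimately have "smult (2 * (2 ^ n * ?H)) ?E = smult (2 ^ n * fact n) ?R"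
    by (simp add: of_nat_poly numeral_poly)
  then have "smult (inverse (2 * (2 ^ n * ?H))) (smult (2 * (2 ^ n * ?H)) ?E) =
      smult (inverse (2 * (2 ^ n * ?H))) (smult (2 ^ n * fact n) ?R)"
    by (rule arg_cong)
  moreover have "?H \<noteq> 0"
    using hook_pos by (auto simp: finite_vertices)
  ultimately show ?thesis
    by (simp add: field_simps)
qed

end
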